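(* Let $p\geq1$ be an integer and let $\mathbf{M}_p$ be the Fraïssé limit of the class of finite integral metric spaces with no triangle of odd perimeter less than $p$. Then $\mathrm{Isom}(\mathbf{M}_p)$ is dissociated.
   Context: An integral metric space is a metric space $(X,d)$ with $d(X\times X)\subseteq\mathbb{N}=\{0,1,2,\dots\}$, viewed as a relational structure with one binary relation $R_n=\{(x,y):d(x,y)=n\}$ for each $n\geq0$. A metric space $(X,d)$ has no triangle of odd perimeter less than $p$ if for every $(x,y,z)\in X^3$ such that $d(x,y)+d(y,z)+d(z,x)$ is odd, one has $d(x,y)+d(y,z)+d(z,x)>p$. The class of finite integral metric spaces with this property is a Fraïssé class; its Fraïssé limit $\mathbf{M}_p$ is the unique (up to isometry) countable integral metric space with no triangle of odd perimeter less than $p$ that contains an isometric copy of every finite one and is metrically homogeneous (every surjective isometry between finite subsets extends to a surjective isometry of the whole space). Let $\Omega$ be the countably infinite underlying set of $\mathbf{M}_p$. $G=\mathrm{Isom}(\mathbf{M}_p)$, the group of surjective isometries, is a closed subgroup of $\mathrm{Sym}(\Omega)$ with the topology of pointwise convergence ($\Omega$ discrete). For $A\subseteq\Omega$, $G_A$ is the pointwise stabilizer of $A$. A unitary representation of $G$ on a Hilbert space $\mathcal{H}$ is a homomorphism $\pi:G\to\mathcal{U}(\mathcal{H})$ with $g\mapsto\pi(g)\xi$ continuous for all $\xi$. It is dissociated if $p_Ap_B=p_{A\cap B}$ for all finite $A,B\subseteq\Omega$, where $p_A$ is the orthogonal projection onto $\mathcal{H}_A=\{\xi\in\mathcal{H}:\pi(g)\xi=\xi\text{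 for all }g\in G_A\}$. $G$ is dissociated if all of its unitary representations are dissociated. *)

theory Defs
  imports "HOL-Analysis.Analysis" "HOL-Algebra.Bij"
begin

section \<open>Complex Hilbert spaces\<close>

text \<open>
  The classes extend \<open>real_inner\<close>, so norm, metric and topology are the library's: the
  underlying real inner product is the real part of the complex one, and the norm of \<open>x\<close> is the
  square root of \<open>cinner x x\<close>. Positive definiteness is inherited from \<open>real_inner\<close>; see
  \<open>cinner_self\<close> below. The form is linear in its first argument.
\<close>

class scaleC = scaleR +
  fixes scaleC :: "complex \<Rightarrow> 'a \<Rightarrow> 'a"  (infixr \<open>*\<^sub>C\<close> 75)
  assumes scaleR_scaleC: "r *\<^sub>R x = complex_of_real r *\<^sub>C x"

class complex_inner = real_inner + scaleC +
  fixes cinner :: "'a \<Rightarrow> 'a \<Rightarrow> complex"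
  assumes scaleC_add_right: "c *\<^sub>C (x + y) = c *\<^sub>C x + c *\<^sub>C y"
    and scaleC_add_left: "(b + c) *\<^sub>C x = b *\<^sub>C x + c *\<^sub>C x"
    and scaleC_scaleC: "b *\<^sub>C c *\<^sub>C x = (b * c) *\<^sub>C x"
    and cinner_cnj_commute: "cinner x y = cnj (cinner y x)"
    and cinner_add_left: "cinner (x + y) z = cinner x z + cinner y z"
    and cinner_scaleC_left: "cinner (c *\<^sub>C x) y = c * cinner x y"
    and inner_eq_Re_cinner: "inner x y = Re (cinner x y)"

class chilbert_space = complex_inner + complete_space

lemma scaleC_one [simp]: "1 *\<^sub>C x = (x :: 'a::complex_inner)"
  using scaleR_scaleC[of 1 x] by simp

global_interpretation complex_vs: vector_space "scaleC :: complex \<Rightarrow> 'a::complex_inner \<Rightarrow> 'a"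
  by unfold_locales (simp_all add: scaleC_add_right scaleC_add_left scaleC_scaleC)

lemma cinner_self: "cinner x x = complex_of_real ((norm (x :: 'a::complex_inner))\<^sup>2)"
proof -
  have "Im (cinner x x) = - Im (cinner x x)"
    using arg_cong[OF cinner_cnj_commute[of x x], of Im] by simp
  then show ?thesis
    by (simp add: complex_eq_iff inner_eq_Re_cinner[symmetric] power2_norm_eq_inner)
qed

instantiation complex :: chilbert_space
begin

definition scaleC_complex_def: "c *\<^sub>C (x :: complex) = c * x"

definition cinner_complex_def: "cinner x (y :: complex) = x * cnj y"

instance
  by intro_classes
    (simp_all add: scaleC_complex_def cinner_complex_def algebra_simps scaleR_conv_of_real
      inner_complex_def)

end

text \<open>
  The vector \<open>orth_proj M x\<close> is the unique \<open>y \<in> M\<close> with \<open>x - y\<close> orthogonal to \<open>M\<close>. It exists when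
  \<open>M\<close> is a closed complex subspace of a Hilbert space, the only case in which it is used.
\<close>

definition orth_proj :: "'h::chilbert_space set \<Rightarrow> 'h \<Rightarrow> 'h" where
  "orth_proj M x = (THE y. y \<in> M \<and> (\<forall>z\<in>M. cinner (x - y) z = 0))"

lemma orth_proj_unique:
  assumes M: "complex_vs.subspace M" and y: "y \<in> M" "\<forall>z\<in>M. cinner (x - y) z = 0"
  shows "orth_proj M x = y"
  unfolding orth_proj_def
proof (rule the_equality)
  fix y' assume y': "y' \<in> M \<and> (\<forall>z\<in>M. cinner (x - y') z = 0)"
  have D: "y' - y \<in> M"
    using M y(1) y' by (simp add: complex_vs.subspace_diff)
  have "cinner ((x - y') + (y' - y)) (y' - y) = cinner (x - y') (y' - y) + cinner (y' - y) (y' - y)"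
    by (rule cinner_add_left)
  then have "cinner (y' - y) (y' - y) = 0"
    using y(2) y' D by simp
  then show "y' = y" by (simp add: cinner_self)
qed (use y in blast)


section \<open>Unitary representations and dissociation\<close>

definition unitary_op :: "('h::chilbert_space \<Rightarrow> 'h) \<Rightarrow> bool" where
  "unitary_op U \<longleftrightarrow> Vector_Spaces.linear (*\<^sub>C) (*\<^sub>C) U \<and> surj U \<and>
     (\<forall>x y. cinner (U x) (U y) = cinner x y)"

definition unitary_group :: "('h::chilbert_space \<Rightarrow> 'h) monoid" where
  "unitary_group = \<lparr>carrier = {U. unitary_op U}, mult = (\<circ>), one = id\<rparr>"

text \<open>
  In the following, \<open>G\<close> is a group of permutations of \<open>\<Omega>\<close>, i.e. a subgroup of \<open>BijGroup \<Omega>\<close>. The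
  elements of \<open>BijGroup \<Omega>\<close> are extensional functions, hence points of the library's product
  topology indexed by \<open>\<Omega>\<close>.
\<close>

definition pointwise_topology :: "'a set \<Rightarrow> ('a \<Rightarrow> 'a) monoid \<Rightarrow> ('a \<Rightarrow> 'a) topology" where
  "pointwise_topology \<Omega> G =
     subtopology (product_topology (\<lambda>_. discrete_topology \<Omega>) \<Omega>) (carrier G)"

definition unitary_rep ::
  "'a set \<Rightarrow> ('a \<Rightarrow> 'a) monoid \<Rightarrow> (('a \<Rightarrow> 'a) \<Rightarrow> 'h::chilbert_space \<Rightarrow> 'h) \<Rightarrow> bool" where
  "unitary_rep \<Omega> G \<pi> \<longleftrightarrow> \<pi> \<in> hom G unitary_group \<and>
     (\<forall>\<xi>. continuous_map (pointwise_topology \<Omega> G) euclidean (\<lambda>g. \<pi> g \<xi>))"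

definition pointwise_stabilizer :: "('a \<Rightarrow> 'a) monoid \<Rightarrow> 'a set \<Rightarrow> ('a \<Rightarrow> 'a) set" where
  "pointwise_stabilizer G A = {g \<in> carrier G. \<forall>a\<in>A. g a = a}"

definition fixed_vectors ::
  "('a \<Rightarrow> 'a) monoid \<Rightarrow> (('a \<Rightarrow> 'a) \<Rightarrow> 'h \<Rightarrow> 'h) \<Rightarrow> 'a set \<Rightarrow> 'h set" where
  "fixed_vectors G \<pi> A = {\<xi>. \<forall>g\<in>pointwise_stabilizer G A. \<pi> g \<xi> = \<xi>}"

definition dissociated_rep ::
  "'a set \<Rightarrow> ('a \<Rightarrow> 'a) monoid \<Rightarrow> (('a \<Rightarrow> 'a) \<Rightarrow> 'h::chilbert_space \<Rightarrow> 'h) \<Rightarrow> bool" where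
  "dissociated_rep \<Omega> G \<pi> \<longleftrightarrow>
     (\<forall>A B. finite A \<and> A \<subseteq> \<Omega> \<and> finite B \<and> B \<subseteq> \<Omega> \<longrightarrow>
        orth_proj (fixed_vectors G \<pi> A) \<circ> orth_proj (fixed_vectors G \<pi> B) =
        orth_proj (fixed_vectors G \<pi> (A \<inter> B)))"

text \<open>
  A formula cannot quantify over all Hilbert spaces, so the type of the Hilbert space is a
  parameter: \<open>G\<close> is dissociated when \<open>dissociated TYPE('h) \<Omega> G\<close> holds for every type \<open>'h\<close>, which
  is what a theorem with a free type variable \<open>'h\<close> asserts.
\<close>

definition dissociated :: "'h::chilbert_space itself \<Rightarrow> 'a set \<Rightarrow> ('a \<Rightarrow> 'a) monoid \<Rightarrow> bool" where
  "dissociated _ \<Omega> G \<longleftrightarrow>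
     (\<forall>\<pi> :: ('a \<Rightarrow> 'a) \<Rightarrow> 'h \<Rightarrow> 'h. unitary_rep \<Omega> G \<pi> \<longrightarrow> dissociated_rep \<Omega> G \<pi>)"


section \<open>Integral metric spaces\<close>

definition integral_metric_space :: "'a set \<Rightarrow> ('a \<Rightarrow> 'a \<Rightarrow> real) \<Rightarrow> bool" where
  "integral_metric_space X d \<longleftrightarrow> Metric_space X d \<and> (\<forall>x\<in>X. \<forall>y\<in>X. d x y \<in> \<nat>)"

text \<open>``No triangle of odd perimeter less than \<open>p\<close>'': odd perimeters have to exceed \<open>p\<close> strictly.\<close>

definition no_small_odd_triangle :: "nat \<Rightarrow> 'a set \<Rightarrow> ('a \<Rightarrow> 'a \<Rightarrow> real) \<Rightarrow> bool" where
  "no_small_odd_triangle p X d \<longleftrightarrow>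
     (\<forall>x\<in>X. \<forall>y\<in>X. \<forall>z\<in>X. \<forall>n::nat. d x y + d y z + d z x = real n \<and> odd n \<longrightarrow> n > p)"

definition isometric_on :: "'a set \<Rightarrow> ('a \<Rightarrow> 'a \<Rightarrow> real) \<Rightarrow> ('b \<Rightarrow> 'b \<Rightarrow> real) \<Rightarrow> ('a \<Rightarrow> 'b) \<Rightarrow> bool" where
  "isometric_on X d d' f \<longleftrightarrow> (\<forall>x\<in>X. \<forall>y\<in>X. d' (f x) (f y) = d x y)"

definition Isom :: "'a set \<Rightarrow> ('a \<Rightarrow> 'a \<Rightarrow> real) \<Rightarrow> ('a \<Rightarrow> 'a) monoid" where
  "Isom X d = (BijGroup X)\<lparr>carrier := {f \<in> Bij X. isometric_on X d d f}\<rparr>"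

lemma subgroup_Isom: "subgroup (carrier (Isom X d)) (BijGroup X)"
proof (rule group.subgroupI[OF group_BijGroup])
  have "(\<lambda>x\<in>X. x) \<in> carrier (Isom X d)"
    by (simp add: Isom_def id_Bij isometric_on_def)
  then show "carrier (Isom X d) \<noteq> {}" by blast
next
  fix f assume f: "f \<in> carrier (Isom X d)"
  then have fB: "f \<in> Bij X" and iso: "isometric_on X d d f" by (auto simp: Isom_def)
  have "d (inv_into X f x) (inv_into X f y) = d x y" if "x \<in> X" "y \<in> X" for x y
  proof -
    have "f (inv_into X f x) = x" "f (inv_into X f y) = y"
      using fB that by (auto simp: Bij_def bij_betw_def f_inv_into_f)
    moreover have "d (f (inv_into X f x)) (f (inv_into X f y))
        = d (inv_into X f x) (inv_into X f y)"
      using iso Bij_inv_into_mem[OF fB] that by (simp add: isometric_on_def)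
    ultimately show ?thesis by simp
  qed
  then show "inv\<^bsub>BijGroup X\<^esub> f \<in> carrier (Isom X d)"
    by (simp add: Isom_def inv_BijGroup[OF fB] restrict_inv_into_Bij[OF fB] isometric_on_def)
next
  fix f g assume fg: "f \<in> carrier (Isom X d)" "g \<in> carrier (Isom X d)"
  then have "g x \<in> X" if "x \<in> X" for x
    using that by (auto simp: Isom_def dest!: Bij_imp_funcset)
  with fg show "f \<otimes>\<^bsub>BijGroup X\<^esub> g \<in> carrier (Isom X d)"
    by (auto simp: Isom_def BijGroup_def isometric_on_def compose_Bij compose_eq)
qed (auto simp: Isom_def BijGroup_def)

definition metrically_homogeneous :: "'a set \<Rightarrow> ('a \<Rightarrow> 'a \<Rightarrow> real) \<Rightarrow> bool" where
  "metrically_homogeneous X d \<longleftrightarrow>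
     (\<forall>A B f. finite A \<and> A \<subseteq> X \<and> finite B \<and> B \<subseteq> X \<and> f ` A = B \<and> isometric_on A d d f \<longrightarrow>
        (\<exists>g\<in>carrier (Isom X d). \<forall>a\<in>A. g a = f a))"

text \<open>
  \<open>is_M p \<Omega> d\<close> says that \<open>(\<Omega>, d)\<close> is (a copy of) the Fraisse limit of the finite integral metric
  spaces with no triangle of odd perimeter less than \<open>p\<close>, which these properties determine up to
  isometry. Every finite metric space is isometric to one whose points are natural numbers, so it
  suffices to let the finite spaces range over subsets of \<open>nat\<close>.
\<close>

definition is_M :: "nat \<Rightarrow> 'a set \<Rightarrow> ('a \<Rightarrow> 'a \<Rightarrow> real) \<Rightarrow> bool" where
  "is_M p \<Omega> d \<longleftrightarrow>
     countable \<Omega> \<and> integral_metric_space \<Omega> d \<and> no_small_odd_triangle p \<Omega> d \<and>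
     (\<forall>(F :: nat set) e. finite F \<and> integral_metric_space F e \<and> no_small_odd_triangle p F e \<longrightarrow>
        (\<exists>f. f ` F \<subseteq> \<Omega> \<and> isometric_on F e d f)) \<and>
     metrically_homogeneous \<Omega> d"

end

theory Submission
  imports Defs
begin

text \<open>
  Write \<open>H_A\<close> for the space of vectors fixed by the pointwise stabilizer of \<open>A\<close>, and \<open>p_A\<close> for the
  projection onto it. An induction on the symmetric difference (\<open>Proj_mult\<close>) reduces the
  identity \<open>p_A p_B = p_(A \<inter> B)\<close> to sets \<open>A = C \<union> {a}\<close> and \<open>B = C \<union> {b}\<close> with distinct points \<open>a\<close>, \<open>b\<close>
  outside \<open>C\<close>. What has to be shown is that \<open>\<xi> \<in> H_A\<close> and \<open>\<eta> \<in> H_B\<close> are orthogonal when \<open>\<xi>\<close> is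
  orthogonal to \<open>H_C\<close> (\<open>Fix_orthogonal\<close>).

  Moving \<open>\<xi>\<close> by the stabilizer of \<open>C\<close> gives a vector \<open>u x\<close> for each point \<open>x\<close> of the orbit of \<open>a\<close>, and
  likewise \<open>w y\<close> for \<open>\<eta>\<close> and the orbit of \<open>b\<close>. By homogeneity, the inner product of \<open>u x\<close> and \<open>w y\<close>
  depends only on the distance of \<open>x\<close> and \<open>y\<close>; the aim is to see that it does not depend
  on that either as long as \<open>x \<noteq> y\<close>.

  The tool is duplication. Every point of a finite set has twins in \<open>\<Omega>\<close>: points at distance 2 with
  the same distances to the other points of the set (\<open>twin\<close>). If \<open>x\<close> and \<open>x'\<close> lie in the orbit of \<open>a\<close> at
  distance 2, replace each by many twins. The vectors of twins of \<open>x\<close> minus those of twins of \<open>x'\<close>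
  are then pairwise orthogonal with constant inner product with \<open>w y\<close>, so Bessel's inequality makes
  this product 0, and \<open>u x\<close>, \<open>u x'\<close> have the same inner product with \<open>w y\<close>
  (\<open>inner_eq_at_distance_2\<close>). Finally, any two points of the orbit are joined by steps of length 2 that
  stay in the orbit and avoid \<open>y\<close> (\<open>orb_connected\<close>). At even distance this is a matter of inserting
  points on a geodesic; at odd distance one has to go around, which is possible as only odd
  perimeters up to \<open>p\<close> are excluded.

  Hence all translates of \<open>\<xi>\<close> that do not take \<open>a\<close> to \<open>b\<close> have the same inner product with \<open>\<eta>\<close>. The
  vector of least norm in the closed convex hull of all translates is fixed by the stabilizer of \<open>C\<close>
  and orthogonal to \<open>H_C\<close>, so it is 0, and there are convex combinations of translates of arbitrarily
  small norm. A further element of the stabilizer moves \<open>a\<close> off \<open>b\<close> in all the finitely many translates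
  that occur, without changing the norm. So the common inner product is 0.
\<close>

section \<open>Orthogonal projections in a Hilbert space\<close>

lemma parallelogram_midpoint:
  fixes x y :: "'h::real_inner"
  shows "(norm (x - y))\<^sup>2 = 2 * (norm x)\<^sup>2 + 2 * (norm y)\<^sup>2 - 4 * (norm ((1/2) *\<^sub>R (x + y)))\<^sup>2"
  by (simp add: power2_norm_eq_inner inner_add_left inner_add_right inner_diff_left
      inner_diff_right inner_commute power_mult_distrib field_simps)

lemma convex_midpoint_mem:
  assumes "convex K" "x \<in> K" "y \<in> K"
  shows "(1/2) *\<^sub>R (x + y) \<in> K"
  using convexD[OF assms, of "1/2" "1/2"] by (simp add: scaleR_right_distrib)

text \<open>
  By the parallelogram identity, two points of a convex set whose norms are close to the infimum
  \<open>m\<close> are close to each other, because their midpoint still has norm at least \<open>m\<close>. So a minimizing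
  sequence is a Cauchy sequence.
\<close>

lemma least_norm_exists:
  fixes K :: "'h::{real_inner,complete_space} set"
  assumes "closed K" "convex K" "K \<noteq> {}"
  obtains y where "y \<in> K" "\<And>z. z \<in> K \<Longrightarrow> norm y \<le> norm z"
proof -
  define m where "m = (INF z\<in>K. norm z)"
  have bdd: "bdd_below (norm ` K)"
    by (rule bdd_belowI[of _ 0]) auto
  have m_le: "m \<le> norm z" if "z \<in> K" for z
    unfolding m_def using bdd that by (rule cINF_lower)
  have m_nonneg: "0 \<le> m"
    unfolding m_def using assms(3) by (intro cINF_greatest) auto
  have "\<exists>z\<in>K. norm z < m + 1 / real (Suc n)" for n
    using cINF_less_iff[OF assms(3) bdd, of "m + 1 / real (Suc n)"] by (simp add: m_def)
  then obtain x where x: "\<And>n. x n \<in> K" "\<And>n. norm (x n) < m + 1 / real (Suc n)"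
    by metis
  have lim_norm: "(\<lambda>n. norm (x n)) \<longlonglongrightarrow> m"
  proof (rule tendsto_sandwich[of "\<lambda>_. m"])
    show "(\<lambda>n. m + 1 / real (Suc n)) \<longlonglongrightarrow> m"
      using tendsto_add[OF tendsto_const LIMSEQ_inverse_real_of_nat, of m]
      by (simp add: inverse_eq_divide)
  qed (use m_le x(1) less_imp_le[OF x(2)] in \<open>auto intro!: always_eventually simp del: of_nat_Suc\<close>)
  have diff_le: "(norm (u - v))\<^sup>2 \<le> 2 * ((norm u)\<^sup>2 - m\<^sup>2) + 2 * ((norm v)\<^sup>2 - m\<^sup>2)"
    if "u \<in> K" "v \<in> K" for u v
  proof -
    have "m\<^sup>2 \<le> (norm ((1/2) *\<^sub>R (u + v)))\<^sup>2"
      using m_le[OF convex_midpoint_mem[OF assms(2) that]] m_nonneg by (rule power_mono)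
    then show ?thesis
      unfolding parallelogram_midpoint[of u v] right_diff_distrib by linarith
  qed
  have "Cauchy x"
  proof (rule metric_CauchyI)
    fix e :: real assume e: "0 < e"
    have "(\<lambda>n. (norm (x n))\<^sup>2) \<longlonglongrightarrow> m\<^sup>2"
      using lim_norm by (rule tendsto_power)
    then have "\<forall>\<^sub>F n in sequentially. (norm (x n))\<^sup>2 < m\<^sup>2 + e\<^sup>2 / 4"
      using e by (intro order_tendstoD) auto
    then obtain N where N: "\<And>n. n \<ge> N \<Longrightarrow> (norm (x n))\<^sup>2 < m\<^sup>2 + e\<^sup>2 / 4"
      by (auto simp: eventually_sequentially)
    have "dist (x i) (x j) < e" if "i \<ge> N" "j \<ge> N" for i j
    proof -
      have "(norm (x i - x j))\<^sup>2 < e\<^sup>2"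
        using diff_le[OF x(1) x(1), of i j] N[OF that(1)] N[OF that(2)] by simp
      then show ?thesis
        using e by (simp add: dist_norm power_less_imp_less_base)
    qed
    then show "\<exists>M. \<forall>i\<ge>M. \<forall>j\<ge>M. dist (x i) (x j) < e" by blast
  qed
  then obtain y where y: "x \<longlonglongrightarrow> y"
    by (auto simp: Cauchy_convergent_iff convergent_def)
  show thesis
  proof
    show "y \<in> K"
      using assms(1) x(1) y by (rule closed_sequentially)
    show "norm y \<le> norm z" if "z \<in> K" for z
      using LIMSEQ_unique[OF tendsto_norm[OF y] lim_norm] m_le[OF that] by simp
  qed
qed

lemma least_norm_unique:
  fixes y z :: "'h::real_inner"
  assumes "convex K" "y \<in> K" "z \<in> K" "norm z = norm y" "\<And>u. u \<in> K \<Longrightarrow> norm y \<le> norm u"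
  shows "z = y"
proof -
  have "(norm y)\<^sup>2 \<le> (norm ((1/2) *\<^sub>R (z + y)))\<^sup>2"
    by (intro power_mono assms(5) convex_midpoint_mem assms) auto
  then have "(norm (z - y))\<^sup>2 \<le> 0"
    unfolding parallelogram_midpoint[of z y] assms(4) by linarith
  then show ?thesis by simp
qed

text \<open>
  Real orthogonality to a complex subspace is complex orthogonality, because the imaginary part of
  \<open>cinner u z\<close> is the real inner product of \<open>u\<close> with \<open>\<i> *\<^sub>C z\<close>. The remaining arguments can therefore use
  the real inner product only.
\<close>

lemma cinner_eq_0_iff_inner:
  assumes "complex_vs.subspace M"
  shows "(\<forall>z\<in>M. cinner u z = 0) \<longleftrightarrow> (\<forall>z\<in>M. inner u z = 0)"
proof safe
  fix z assume inner0: "\<forall>z\<in>M. inner u z = 0" and z: "z \<in> M"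
  have "cinner u (\<i> *\<^sub>C z) = cnj (\<i> * cinner z u)"
    by (subst cinner_cnj_commute) (simp add: cinner_scaleC_left)
  also have "\<dots> = - \<i> * cinner u z"
    by (subst (2) cinner_cnj_commute) simp
  finally have "Im (cinner u z) = inner u (\<i> *\<^sub>C z)"
    by (simp add: inner_eq_Re_cinner)
  moreover have "\<i> *\<^sub>C z \<in> M"
    using assms z by (rule complex_vs.subspace_scale)
  ultimately show "cinner u z = 0"
    using inner0 z by (simp add: complex_eq_iff inner_eq_Re_cinner[symmetric])
qed (simp add: inner_eq_Re_cinner)

lemma complex_subspace_scaleR:
  assumes "complex_vs.subspace M" "x \<in> M"
  shows "r *\<^sub>R x \<in> M"
  unfolding scaleR_scaleC using assms by (rule complex_vs.subspace_scale)

text \<open>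
  The residue \<open>x - orth_proj M x\<close> is the vector of least norm in the translate \<open>x - M\<close>.
\<close>

lemma orth_proj_exists:
  fixes M :: "'h::chilbert_space set"
  assumes sub: "complex_vs.subspace M" and "closed M"
  shows "orth_proj M x \<in> M \<and> (\<forall>z\<in>M. inner (x - orth_proj M x) z = 0)"
proof -
  define K where "K = {u. x - u \<in> M}"
  have "closed K"
    unfolding K_def using \<open>closed M\<close>
    by (intro closed_vimage[of M "\<lambda>u. x - u", unfolded vimage_def] continuous_intros)
  moreover have "convex K"
  proof (rule convexI)
    fix u v :: 'h and s t :: real
    assume uv: "u \<in> K" "v \<in> K" and st: "0 \<le> s" "0 \<le> t" "s + t = 1"
    have "x = s *\<^sub>R x + t *\<^sub>R x"
      using st(3) by (simp flip: scaleR_left_distrib)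
    then have "x - (s *\<^sub>R u + t *\<^sub>R v) = s *\<^sub>R (x - u) + t *\<^sub>R (x - v)"
      by (simp add: algebra_simps)
    then show "s *\<^sub>R u + t *\<^sub>R v \<in> K"
      using uv by (simp add: K_def complex_vs.subspace_add[OF sub] complex_subspace_scaleR[OF sub])
  qed
  moreover have "K \<noteq> {}"
    using complex_vs.subspace_0[OF sub] by (auto simp: K_def intro: exI[of _ x])
  ultimately obtain u where u: "u \<in> K" and least: "\<And>v. v \<in> K \<Longrightarrow> norm u \<le> norm v"
    using least_norm_exists by blast
  have orth: "inner u z = 0" if z: "z \<in> M" for z
  proof (cases "z = 0")
    case False
    define t where "t = inner u z / inner z z"
    have "(x - u) + t *\<^sub>R z \<in> M"
      using u z by (simp add: K_def complex_vs.subspace_add[OF sub] complex_subspace_scaleR[OF sub])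
    then have "u - t *\<^sub>R z \<in> K"
      by (simp add: K_def algebra_simps)
    then have "(norm u)\<^sup>2 \<le> (norm (u - t *\<^sub>R z))\<^sup>2"
      using least by (simp add: power_mono)
    also have "\<dots> = (norm u)\<^sup>2 - (inner u z)\<^sup>2 / inner z z"
      using False unfolding power2_norm_eq_inner
      by (simp add: inner_diff_left inner_diff_right inner_commute t_def power2_eq_square
          field_simps)
    finally have "(inner u z)\<^sup>2 / inner z z \<le> 0" by simp
    moreover have "0 < inner z z"
      using False by simp
    ultimately have "(inner u z)\<^sup>2 \<le> 0"
      unfolding divide_le_0_iff by linarith
    then show ?thesis by simp
  qed simp
  have "orth_proj M x = x - u"
    using u orth by (intro orth_proj_unique sub) (simp_all add: K_def cinner_eq_0_iff_inner[OF sub])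
  then show ?thesis
    using u orth by (simp add: K_def)
qed

lemma orth_proj_eqI:
  assumes "complex_vs.subspace M" "y \<in> M" "\<And>z. z \<in> M \<Longrightarrow> inner (x - y) z = 0"
  shows "orth_proj M x = y"
  using assms by (intro orth_proj_unique) (simp_all add: cinner_eq_0_iff_inner)

text \<open>
  Only boundedly many orthogonal vectors of a given length can have a given nonzero inner product
  with a fixed vector, by Bessel's inequality.
\<close>

lemma inner_eq_0_if_orthogonal_families:
  fixes v :: "'h::real_inner"
  assumes fam: "\<And>n::nat. \<exists>\<delta>. (\<forall>i<n. inner (\<delta> i) v = c \<and> inner (\<delta> i) (\<delta> i) = s) \<and>
    (\<forall>i<n. \<forall>j<n. i \<noteq> j \<longrightarrow> inner (\<delta> i) (\<delta> j) = 0)"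
  shows "c = 0"
proof -
  have bound: "real n * c\<^sup>2 \<le> s * (norm v)\<^sup>2" if "n > 0" for n
  proof -
    obtain \<delta> where \<delta>: "\<And>i. i < n \<Longrightarrow> inner (\<delta> i) v = c" "\<And>i. i < n \<Longrightarrow> inner (\<delta> i) (\<delta> i) = s"
      "\<And>i j. i < n \<Longrightarrow> j < n \<Longrightarrow> i \<noteq> j \<Longrightarrow> inner (\<delta> i) (\<delta> j) = 0"
      using fam[of n] by blast
    define S where "S = (\<Sum>i<n. \<delta> i)"
    have "inner S v = (\<Sum>i<n. inner (\<delta> i) v)"
      by (simp add: S_def inner_sum_left)
    then have Sv: "inner S v = real n * c"
      using \<delta>(1) by simp
    have "inner S S = (\<Sum>i<n. \<Sum>j<n. inner (\<delta> i) (\<delta> j))"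
      unfolding S_def inner_sum_left inner_sum_right by (rule sum.swap)
    also have "\<dots> = (\<Sum>i<n. \<Sum>j<n. if j = i then s else 0)"
      using \<delta> by (intro sum.cong refl) auto
    finally have SS: "(norm S)\<^sup>2 = real n * s"
      by (simp add: power2_norm_eq_inner)
    have "(real n * c)\<^sup>2 \<le> (norm S)\<^sup>2 * (norm v)\<^sup>2"
      using Cauchy_Schwarz_ineq[of S v] by (simp add: Sv power2_norm_eq_inner)
    then have "real n * (real n * c\<^sup>2) \<le> real n * (s * (norm v)\<^sup>2)"
      by (simp only: SS power_mult_distrib power2_eq_square[of "real n"] mult_ac)
    then show ?thesis
      using that by (simp add: mult_le_cancel_left_pos)
  qed
  show ?thesis
  proof (rule ccontr)
    assume "c \<noteq> 0"
    then obtain n :: nat where "s * (norm v)\<^sup>2 < real n * c\<^sup>2"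
      using ex_less_of_nat_mult[of "c\<^sup>2"] by auto
    moreover have "0 \<le> s * (norm v)\<^sup>2"
      using order_trans[OF zero_le_power2 bound[of 1, simplified]] by simp
    ultimately show False
      using bound[of n] by (cases "n = 0") auto
  qed
qed

section \<open>One-point extensions of the universal space\<close>

lemma Isom_mem:
  assumes "g \<in> carrier (Isom X d)" "x \<in> X"
  shows "g x \<in> X"
  using assms by (auto simp: Isom_def dest!: Bij_imp_funcset)

fun add_point :: "('a \<Rightarrow> 'a \<Rightarrow> nat) \<Rightarrow> ('a \<Rightarrow> nat) \<Rightarrow> 'a option \<Rightarrow> 'a option \<Rightarrow> nat" where
  "add_point D f (Some x) (Some y) = D x y"
| "add_point D f (Some x) None = f x"
| "add_point D f None (Some y) = f y"
| "add_point D f None None = 0"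

locale fraisse_space =
  fixes p :: nat and \<Omega> :: "'a set" and d :: "'a \<Rightarrow> 'a \<Rightarrow> real"
  assumes is_M: "is_M p \<Omega> d"
begin

abbreviation stab :: "'a set \<Rightarrow> ('a \<Rightarrow> 'a) set" where
  "stab C \<equiv> pointwise_stabilizer (Isom \<Omega> d) C"

sublocale Metric_space \<Omega> d
  using is_M by (simp add: is_M_def integral_metric_space_def)

text \<open>
  On \<open>\<Omega>\<close> this is the distance itself. Natural numbers make parities directly expressible.
\<close>

definition D :: "'a \<Rightarrow> 'a \<Rightarrow> nat" where
  "D x y = nat \<lfloor>d x y\<rfloor>"

lemma d_eq_D: "x \<in> \<Omega> \<Longrightarrow> y \<in> \<Omega> \<Longrightarrow> d x y = real (D x y)"
proof -
  assume "x \<in> \<Omega>" "y \<in> \<Omega>"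
  then have "d x y \<in> \<nat>"
    using is_M by (simp add: is_M_def integral_metric_space_def)
  then show ?thesis by (auto simp: D_def elim!: Nats_cases)
qed

lemma D_commute: "D x y = D y x"
  by (simp add: D_def commute)

lemma D_eq_0_iff: "x \<in> \<Omega> \<Longrightarrow> y \<in> \<Omega> \<Longrightarrow> D x y = 0 \<longleftrightarrow> x = y"
  using zero[of x y] by (simp add: d_eq_D)

lemma D_triangle: "x \<in> \<Omega> \<Longrightarrow> y \<in> \<Omega> \<Longrightarrow> z \<in> \<Omega> \<Longrightarrow> D x z \<le> D x y + D y z"
  using triangle[of x y z] by (simp add: d_eq_D flip: of_nat_add)

lemma D_isometry:
  assumes "g \<in> carrier (Isom \<Omega> d)" "x \<in> \<Omega>" "y \<in> \<Omega>"
  shows "D (g x) (g y) = D x y"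
  using assms by (simp add: D_def Isom_def isometric_on_def)

text \<open>
  The condition for \<open>i\<close>, \<open>j\<close>, \<open>k\<close> to be the sides of a triangle of the class. In use, \<open>i\<close> and \<open>j\<close> are
  the distances from a prospective new point to two given points and \<open>k\<close> is the distance between
  these two.
\<close>

definition admissible :: "nat \<Rightarrow> nat \<Rightarrow> nat \<Rightarrow> bool" where
  "admissible i j k \<longleftrightarrow>
     i \<le> j + k \<and> j \<le> i + k \<and> k \<le> i + j \<and> (odd (i + j + k) \<longrightarrow> p < i + j + k)"

lemma admissible_swap: "admissible i j k \<longleftrightarrow> admissible j i k"
  by (auto simp: admissible_def add_ac)

lemma admissible_triangle:
  assumes "x \<in> \<Omega>" "y \<in> \<Omega>" "z \<in> \<Omega>"
  shows "admissible (D z x) (D z y) (D x y)"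
proof -
  have "p < D z x + D z y + D x y" if "odd (D z x + D z y + D x y)"
  proof -
    have "d z x + d x y + d y z = real (D z x + D z y + D x y)"
      using assms by (simp add: d_eq_D D_commute)
    moreover have "no_small_odd_triangle p \<Omega> d"
      using is_M by (simp add: is_M_def)
    then have "d z x + d x y + d y z = real n \<and> odd n \<longrightarrow> p < n" for n :: nat
      using assms unfolding no_small_odd_triangle_def by blast
    ultimately show ?thesis
      using that by blast
  qed
  then show ?thesis
    using assms D_triangle[of z y x] D_triangle[of z x y] D_triangle[of x z y]
    by (simp add: admissible_def D_commute)
qed

lemma extend_isometry:
  assumes "finite A" "A \<subseteq> \<Omega>" "f ` A \<subseteq> \<Omega>" "isometric_on A d d f"
  shows "\<exists>g\<in>carrier (Isom \<Omega> d). \<forall>a\<in>A. g a = f a"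
proof -
  have "metrically_homogeneous \<Omega> d"
    using is_M by (simp add: is_M_def)
  then show ?thesis
    using assms unfolding metrically_homogeneous_def by (metis finite_imageI)
qed

lemma universal:
  fixes F :: "nat set"
  assumes "finite F" "integral_metric_space F e" "no_small_odd_triangle p F e"
  shows "\<exists>f. f ` F \<subseteq> \<Omega> \<and> isometric_on F e d f"
  using is_M assms by (simp add: is_M_def)

text \<open>
  Finite spaces whose points are not natural numbers, such as the one-point extensions below,
  inherit embeddability along an enumeration of their points.
\<close>

lemma finite_space_embeds:
  fixes X :: "'b set"
  assumes "finite X" "integral_metric_space X e" "no_small_odd_triangle p X e"
  shows "\<exists>k. k ` X \<subseteq> \<Omega> \<and> isometric_on X e d k"
proof -
  obtain h where h: "bij_betw h {0..<card X} X"
    using ex_bij_betw_nat_finite[OF assms(1)] by blast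
  define N where "N = {0..<card X}"
  have hX: "h i \<in> X" if "i \<in> N" for i
    using h that by (auto simp: bij_betw_def N_def)
  interpret X: Metric_space X e
    using assms(2) by (simp add: integral_metric_space_def)
  have "Metric_space N (\<lambda>i j. e (h i) (h j))"
  proof
    show "(e (h i) (h j) = 0) = (i = j)" if "i \<in> N" "j \<in> N" for i j
      using that hX X.zero inj_onD[OF bij_betw_imp_inj_on[OF h]] by (auto simp: N_def)
  qed (use hX X.commute X.triangle in auto)
  then have "integral_metric_space N (\<lambda>i j. e (h i) (h j))"
    using assms(2) hX by (simp add: integral_metric_space_def)
  moreover have "no_small_odd_triangle p N (\<lambda>i j. e (h i) (h j))"
    using assms(3) hX unfolding no_small_odd_triangle_def by blast
  ultimately obtain f where f: "f ` N \<subseteq> \<Omega>" "isometric_on N (\<lambda>i j. e (h i) (h j)) d f"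
    using universal[of N "\<lambda>i j. e (h i) (h j)"] unfolding N_def by blast
  define k where "k = f \<circ> inv_into N h"
  have inv: "inv_into N h x \<in> N" "h (inv_into N h x) = x" if "x \<in> X" for x
    using inv_into_into[of x h N] f_inv_into_f[of x h N] bij_betw_imp_surj_on[OF h] that
    by (simp_all add: N_def)
  have "k ` X \<subseteq> \<Omega>" "isometric_on X e d k"
    using f inv by (auto simp: k_def isometric_on_def)
  then show ?thesis by blast
qed

text \<open>
  The prescribed distances turn \<open>F\<close> with one more point into a finite space of the class. An
  embedded copy of this space exists by universality, and homogeneity moves the copy of \<open>F\<close> back to
  \<open>F\<close>; the image of the extra point is the point sought.
\<close>

lemma one_point_extension:
  assumes F: "finite F" "F \<subseteq> \<Omega>"
    and f: "\<And>w. w \<in> F \<Longrightarrow> 0 < f w"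
      "\<And>w w'. w \<in> F \<Longrightarrow> w' \<in> F \<Longrightarrow> admissible (f w) (f w') (D w w')"
  shows "\<exists>z\<in>\<Omega>. \<forall>w\<in>F. D z w = f w"
proof -
  define X where "X = insert None (Some ` F)"
  let ?N = "add_point D f"
  let ?e = "\<lambda>x y. real (?N x y)"
  have dD: "d w w' = real (D w w')" if "w \<in> F" "w' \<in> F" for w w'
    using that F by (intro d_eq_D) auto
  have self: "D w w = 0" if "w \<in> F" for w
    using that F D_eq_0_iff by blast
  have adm_f: "admissible (f w) (f w') (D w w')" "admissible (f w) (D w w') (f w')"
    "admissible (D w w') (f w) (f w')" if "w \<in> F" "w' \<in> F" for w w'
    using f(2)[OF that] by (auto simp: admissible_def add_ac)
  have adm_ff: "admissible (f w) (f w) 0" "admissible (f w) 0 (f w)" "admissible 0 (f w) (f w)" for w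
    by (auto simp: admissible_def)
  have adm: "admissible (?N z x) (?N z y) (?N x y)" if "x \<in> X" "y \<in> X" "z \<in> X" for x y z
    using that F
    by (cases x; cases y; cases z)
      (auto simp: X_def adm_f adm_ff subset_iff intro!: admissible_triangle, simp add: admissible_def)
  have N_commute: "?N x y = ?N y x" for x y
    by (cases x; cases y) (simp_all add: D_commute)
  have "Metric_space X ?e"
  proof
    show "(?e x y = 0) = (x = y)" if "x \<in> X" "y \<in> X" for x y
      using that F f(1) D_eq_0_iff by (cases x; cases y) (auto simp: X_def subset_iff)
    show "?e x z \<le> ?e x y + ?e y z" if "x \<in> X" "y \<in> X" "z \<in> X" for x y z
      using adm[OF that(1,3,2)] N_commute[of x y]
      by (simp add: admissible_def flip: of_nat_add)
  qed (simp_all add: N_commute)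
  then have int: "integral_metric_space X ?e"
    by (simp add: integral_metric_space_def)
  have odd: "no_small_odd_triangle p X ?e"
    unfolding no_small_odd_triangle_def
  proof (intro ballI allI impI)
    fix x y z and n :: nat
    assume xyz: "x \<in> X" "y \<in> X" "z \<in> X" and n: "?e x y + ?e y z + ?e z x = real n \<and> odd n"
    then have "n = ?N z x + ?N z y + ?N x y"
      using N_commute[of y z] by (simp flip: of_nat_add add: add_ac)
    then show "p < n"
      using adm[OF xyz] n by (simp add: admissible_def)
  qed
  have "finite X" by (simp add: X_def F)
  then obtain k where k: "k ` X \<subseteq> \<Omega>" "isometric_on X ?e d k"
    using finite_space_embeds int odd by blast
  define B where "B = (k \<circ> Some) ` F"
  have k_iso: "d (k (Some w)) (k (Some w')) = d w w'" "d (k None) (k (Some w)) = real (f w)"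
    if "w \<in> F" "w' \<in> F" for w w'
    using k(2) that by (auto simp: isometric_on_def X_def dD)
  have k_mem: "k None \<in> \<Omega>" "\<And>w. w \<in> F \<Longrightarrow> k (Some w) \<in> \<Omega>"
    using k(1) by (auto simp: X_def)
  have "inj_on (k \<circ> Some) F"
  proof (rule inj_onI)
    fix w w' assume w: "w \<in> F" "w' \<in> F" and "(k \<circ> Some) w = (k \<circ> Some) w'"
    then have "d w w' = 0" 
      using k_iso(1)[OF w] k_mem by simp
    then show "w = w'" using zero[of w w'] w F by (auto simp: subset_iff)
  qed
  then have inv: "inv_into F (k \<circ> Some) (k (Some w)) = w" if "w \<in> F" for w
    using that inv_into_f_f[of "k \<circ> Some" F w] by simp
  have "\<exists>g\<in>carrier (Isom \<Omega> d). \<forall>b\<in>B. g b = inv_into F (k \<circ> Some) b"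
  proof -
    have "finite B" "B \<subseteq> \<Omega>" "inv_into F (k \<circ> Some) ` B = F"
      using F inv k_mem by (auto simp: B_def image_image)
    moreover have "isometric_on B d d (inv_into F (k \<circ> Some))"
      using inv k_iso by (auto simp: isometric_on_def B_def)
    ultimately show ?thesis
      using F by (intro extend_isometry) auto
  qed
  then obtain g where g: "g \<in> carrier (Isom \<Omega> d)" "\<And>w. w \<in> F \<Longrightarrow> g (k (Some w)) = w"
    using inv by (auto simp: B_def)
  have "D (g (k None)) w = f w" if "w \<in> F" for w
    using D_isometry[OF g(1) k_mem(1) k_mem(2)[OF that]] g(2)[OF that] k_iso(2)[OF that that]
    by (simp add: D_def)
  then show ?thesis
    using Isom_mem[OF g(1) k_mem(1)] by blast
qed

text \<open>
  A twin of \<open>x\<close> is a point at distance 2 from \<open>x\<close> that no other point of \<open>F\<close> can tell from \<open>x\<close>.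
  Twins exist because 2 is even and at most twice any positive distance: the new triangles
  have sides \<open>2, k, k\<close>, or are old triangles with \<open>x\<close> replaced. So the odd perimeters are old ones.
\<close>

lemma twin:
  assumes F: "finite F" "F \<subseteq> \<Omega>" and x: "x \<in> F"
  shows "\<exists>z\<in>\<Omega>. D z x = 2 \<and> (\<forall>w\<in>F - {x}. D z w = D x w)"
proof -
  define f where "f w = (if w = x then 2 else D x w)" for w
  have pos: "D x w > 0" if "w \<in> F" "w \<noteq> x" for w
    using that F x D_eq_0_iff[of x w] by auto
  have "admissible (f w) (f w') (D w w')" if "w \<in> F" "w' \<in> F" for w w'
  proof -
    have "admissible 2 (D x v) (D x v)" if "v \<in> F" "v \<noteq> x" for v
      using pos[OF that] by (simp add: admissible_def)
    moreover have "admissible 2 2 (D x x)"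
      using F x D_eq_0_iff[of x x] by (auto simp: admissible_def)
    moreover have "admissible (D x w) (D x w') (D w w')"
      using admissible_triangle that F x by blast
    ultimately show ?thesis
      using that admissible_swap by (auto simp: f_def D_commute)
  qed
  moreover have "0 < f w" if "w \<in> F" for w
    using pos[OF that] by (simp add: f_def)
  ultimately obtain z where "z \<in> \<Omega>" "\<And>w. w \<in> F \<Longrightarrow> D z w = f w"
    using one_point_extension[OF F, of f] by blast
  then show ?thesis
    using x by (intro bexI[of _ z]) (auto simp: f_def)
qed

text \<open>
  Adding each new twin to \<open>F\<close> before taking the next one makes the twins also mutual twins: \<open>x\<close> lies
  at distance 2 from the earlier ones, hence so does the new one.
\<close>

lemma twin_sequence:
  fixes n :: nat
  assumes F: "finite F" "F \<subseteq> \<Omega>" and x: "x \<in> F"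
  shows "\<exists>t. (\<forall>i<n. t i \<in> \<Omega> \<and> D (t i) x = 2 \<and> (\<forall>w\<in>F - {x}. D (t i) w = D x w)) \<and>
    (\<forall>i<n. \<forall>j<n. i \<noteq> j \<longrightarrow> D (t i) (t j) = 2)"
proof (induction n)
  case (Suc n)
  then obtain t where t: "\<And>i. i < n \<Longrightarrow> t i \<in> \<Omega> \<and> D (t i) x = 2 \<and> (\<forall>w\<in>F - {x}. D (t i) w = D x w)"
    "\<And>i j. i < n \<Longrightarrow> j < n \<Longrightarrow> i \<noteq> j \<Longrightarrow> D (t i) (t j) = 2"
    by blast
  obtain z where z: "z \<in> \<Omega>" "D z x = 2" "\<And>w. w \<in> F \<union> t ` {..<n} - {x} \<Longrightarrow> D z w = D x w"
  proof -
    have "finite (F \<union> t ` {..<n})" "F \<union> t ` {..<n} \<subseteq> \<Omega>" "x \<in> F \<union> t ` {..<n}"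
      using F x t(1) by auto
    from twin[OF this] show ?thesis using that by blast
  qed
  have zt: "D z (t i) = 2" "D (t i) z = 2" if "i < n" for i
  proof -
    have "t i \<noteq> x"
      using t(1)[OF that] D_eq_0_iff[of x x] by auto
    then show "D z (t i) = 2"
      using z(3)[of "t i"] t(1)[OF that] that by (simp add: D_commute)
    then show "D (t i) z = 2" by (simp add: D_commute)
  qed
  show ?case
    by (rule exI[of _ "t(n := z)"]) (use t z zt in \<open>auto simp: less_Suc_eq\<close>)
qed simp

text \<open>
  A solution of an extension problem may be replaced by a twin of it that is away from \<open>E\<close>.
\<close>

lemma one_point_extension_avoiding:
  assumes F: "finite F" "F \<subseteq> \<Omega>" and E: "finite E" "E \<subseteq> \<Omega>"
    and f: "\<And>w. w \<in> F \<Longrightarrow> 0 < f w"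
      "\<And>w w'. w \<in> F \<Longrightarrow> w' \<in> F \<Longrightarrow> admissible (f w) (f w') (D w w')"
  shows "\<exists>z\<in>\<Omega> - E. \<forall>w\<in>F. D z w = f w"
proof -
  obtain z where z: "z \<in> \<Omega>" "\<And>w. w \<in> F \<Longrightarrow> D z w = f w"
    using one_point_extension[OF F f] by blast
  obtain z' where z': "z' \<in> \<Omega>" "D z' z = 2" "\<And>w. w \<in> insert z (F \<union> E) - {z} \<Longrightarrow> D z' w = D z w"
    using twin[of "insert z (F \<union> E)" z] F E z(1) by auto
  have "z \<notin> F"
    using f(1) z D_eq_0_iff[of z z] by fastforce
  moreover have "z' \<notin> E"
    using z' D_eq_0_iff[of z' z'] D_eq_0_iff[of z z'] z(1)
    by (metis Diff_iff UnI2 insertCI insertE zero_neq_numeral singletonD)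
  moreover have "D z' w = f w" if "w \<in> F" for w
    using z'(3)[of w] z(2)[OF that] that \<open>z \<notin> F\<close> by auto
  ultimately show ?thesis
    using z'(1) by blast
qed

lemma stab_transitive_on_pairs:
  assumes C: "finite C" "C \<subseteq> \<Omega>" and mem: "x \<in> \<Omega>" "y \<in> \<Omega>" "x' \<in> \<Omega>" "y' \<in> \<Omega>"
    and D: "\<And>c. c \<in> C \<Longrightarrow> D x c = D x' c" "\<And>c. c \<in> C \<Longrightarrow> D y c = D y' c" "D x y = D x' y'"
  shows "\<exists>k\<in>stab C. k x = x' \<and> k y = y'"
proof -
  define f where "f w = (if w = x then x' else if w = y then y' else w)" for w
  have fC: "f c = c" if "c \<in> C" for c
    using D(1,2)[OF that] that mem D_eq_0_iff[of x x] D_eq_0_iff[of x' x]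
      D_eq_0_iff[of y y] D_eq_0_iff[of y' y]
    by (auto simp: f_def)
  have fy: "f y = y'"
    using D(3) mem D_eq_0_iff[of x x] D_eq_0_iff[of x' y'] by (auto simp: f_def)
  have fx: "f x = x'" by (simp add: f_def)
  have self: "D z z = 0" if "z \<in> \<Omega>" for z
    using that D_eq_0_iff by blast
  let ?A = "insert x (insert y C)"
  have f_mem: "f w \<in> \<Omega>" if "w \<in> ?A" for w
    using that C mem fC fx fy by auto
  have to_C: "D x' c = D x c" "D c x' = D c x" "D y' c = D y c" "D c y' = D c y" if "c \<in> C" for c
    using D(1,2)[OF that] by (simp_all add: D_commute[of c])
  have x'y': "D x' y' = D x y" "D y' x' = D y x"
    using D(3) by (simp_all add: D_commute[of y' x'] D_commute[of y x])
  have "D (f w) (f w') = D w w'" if "w \<in> ?A" "w' \<in> ?A" for w w'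
    using that by (elim insertE) (simp_all add: fC fx fy to_C x'y' self mem)
  moreover have A: "finite ?A" "?A \<subseteq> \<Omega>"
    using C mem by auto
  ultimately have "isometric_on ?A d d f"
    unfolding isometric_on_def by (metis d_eq_D f_mem subsetD)
  moreover have "f ` ?A \<subseteq> \<Omega>"
    using f_mem by blast
  ultimately obtain k where "k \<in> carrier (Isom \<Omega> d)" "\<forall>w\<in>?A. k w = f w"
    using extend_isometry[OF A] by meson
  then show ?thesis
    using fC fx fy by (intro bexI[of _ k]) (auto simp: pointwise_stabilizer_def)
qed

section \<open>Orbits of pointwise stabilizers are connected\<close>

text \<open>
  By homogeneity these are the points of the orbit of \<open>a\<close> under the pointwise stabilizer of \<open>C\<close>.
\<close>

definition orb :: "'a set \<Rightarrow> 'a \<Rightarrow> 'a set" where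
  "orb C a = {x \<in> \<Omega>. \<forall>c\<in>C. D x c = D a c}"

lemma orb_disjoint: "a \<in> \<Omega> - C \<Longrightarrow> C \<subseteq> \<Omega> \<Longrightarrow> x \<in> orb C a \<Longrightarrow> x \<notin> C"
  using D_eq_0_iff[of x x] D_eq_0_iff[of a x] by (auto simp: orb_def)

lemma orb_stab_mem:
  assumes "x \<in> orb C a" "g \<in> stab C" "C \<subseteq> \<Omega>"
  shows "g x \<in> orb C a"
proof -
  have g: "g \<in> carrier (Isom \<Omega> d)" "\<And>c. c \<in> C \<Longrightarrow> g c = c"
    using assms(2) by (auto simp: pointwise_stabilizer_def)
  have "D (g x) c = D x c" if "c \<in> C" for c
    using D_isometry[OF g(1), of x c] g(2)[OF that] that assms by (auto simp: orb_def)
  then show ?thesis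
    using assms Isom_mem[OF g(1)] by (auto simp: orb_def)
qed

text \<open>
  Being at the distances \<open>D a c\<close> from \<open>C\<close>, the new point forms with \<open>x\<close> and \<open>c\<close> a triangle of sides
  \<open>q\<close>, \<open>D a c\<close>, \<open>D a c\<close>, and likewise for \<open>x'\<close> and \<open>r\<close>. As \<open>q\<close> and \<open>r\<close> are even, no parity
  obstruction can come from \<open>C\<close>, and only the triangle with \<open>x\<close> and \<open>x'\<close> remains to be checked.
\<close>

lemma orb_intermediate_point:
  assumes C: "finite C" "C \<subseteq> \<Omega>" and a: "a \<in> \<Omega> - C" and E: "finite E" "E \<subseteq> \<Omega>"
    and x: "x \<in> orb C a" "x' \<in> orb C a" "x \<noteq> x'"
    and even: "even q" "even r" "0 < q" "0 < r"
    and le: "\<And>c. c \<in> C \<Longrightarrow> q \<le> 2 * D a c" "\<And>c. c \<in> C \<Longrightarrow> r \<le> 2 * D a c"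
    and adm: "admissible q r (D x x')"
  shows "\<exists>z\<in>orb C a - E. D z x = q \<and> D z x' = r"
proof -
  define f where "f w = (if w = x then q else if w = x' then r else D a w)" for w
  have pos: "D a c > 0" if "c \<in> C" for c
    using that a C D_eq_0_iff[of a c] by auto
  have x_mem: "x \<in> \<Omega>" "x' \<in> \<Omega>"
    using x by (auto simp: orb_def)
  have notC: "x \<notin> C" "x' \<notin> C"
    using x(1,2) orb_disjoint[OF a C(2)] by blast+
  have fC: "f c = D a c" if "c \<in> C" for c
    using notC that by (auto simp: f_def)
  have fx: "f x = q" "f x' = r"
    using x(3) by (auto simp: f_def)
  have self: "D z z = 0" if "z \<in> \<Omega>" for z
    using that D_eq_0_iff by blast
  have adm_C: "admissible (D a c) (D a c') (D c c')" if "c \<in> C" "c' \<in> C" for c c'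
    using admissible_triangle that a C by blast
  have adm_x: "admissible q (D a c) (D x c)" "admissible r (D a c) (D x' c)" if "c \<in> C" for c
    using x le[OF that] even that by (auto simp: admissible_def orb_def)
  have adm_x': "admissible (D a c) q (D c x)" "admissible (D a c) r (D c x')" if "c \<in> C" for c
    using adm_x[OF that] by (simp_all add: admissible_swap[of "D a c"] D_commute[of c])
  have adm': "admissible r q (D x' x)"
    using adm by (simp add: admissible_swap[of r] D_commute[of x'])
  have adm_self: "admissible q q 0" "admissible r r 0"
    using even by (auto simp: admissible_def)
  have "\<exists>z\<in>\<Omega> - E. \<forall>w\<in>insert x (insert x' C). D z w = f w"
  proof (rule one_point_extension_avoiding)
    fix w w' assume w: "w \<in> insert x (insert x' C)" "w' \<in> insert x (insert x' C)"
    then show "admissible (f w) (f w') (D w w')"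
      by (elim insertE) (simp_all add: fC fx self x_mem adm adm' adm_C adm_x adm_x' adm_self)
  qed (use C E x_mem pos even fC fx in auto)
  then show ?thesis
    using fC fx by (auto simp: orb_def)
qed

text \<open>
  Two points of the orbit at even distance are joined by a walk inside the orbit with steps of
  length 2: put a point at distance 2 from one end and two less than before from the other end.
\<close>

lemma orb_connected_even:
  assumes C: "finite C" "C \<subseteq> \<Omega>" and a: "a \<in> \<Omega> - C" and E: "finite E" "E \<subseteq> \<Omega>"
    and step: "\<And>z z'. z \<in> orb C a - E \<Longrightarrow> z' \<in> orb C a - E \<Longrightarrow> D z z' = 2 \<Longrightarrow> \<phi> z = \<phi> z'"
    and x: "x \<in> orb C a - E" "x' \<in> orb C a - E" "D x x' = 2 * m"
  shows "\<phi> x = \<phi> x'"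
  using x(1,3)
proof (induction m arbitrary: x)
  case 0
  then have "x = x'"
    using x(2) D_eq_0_iff by (auto simp: orb_def)
  then show ?case by simp
next
  case (Suc m)
  show ?case
  proof (cases "m = 0")
    case True
    then show ?thesis using step Suc.prems x(2) by simp
  next
    case False
    have "x \<noteq> x'"
      using Suc.prems x(2) D_eq_0_iff[of x x'] by (auto simp: orb_def)
    moreover have "2 * Suc m \<le> 2 * D a c" if "c \<in> C" for c
      using D_triangle[of x c x'] Suc.prems x(2) that C by (auto simp: orb_def D_commute)
    ultimately have "\<exists>z\<in>orb C a - E. D z x = 2 \<and> D z x' = 2 * m"
      using Suc.prems x(2) False
      by (intro orb_intermediate_point C a E) (force simp: admissible_def)+
    then obtain z where z: "z \<in> orb C a - E" "D z x = 2" "D z x' = 2 * m" by blast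
    then show ?thesis
      using step[OF z(1) _ z(2)] Suc.IH[OF z(1,3)] Suc.prems by simp
  qed
qed

text \<open>
  The same holds at odd distance. One makes a detour through a point \<open>z\<close> at the same even distance
  \<open>L\<close> from both ends, and has to make the odd perimeter \<open>L + L + D x x'\<close> large. For \<open>C\<close> empty, \<open>L\<close> can
  be arbitrarily large. Otherwise the largest possible \<open>L\<close> is \<open>2 * D a c\<close> with \<open>c\<close> the point of \<open>C\<close>
  nearest to \<open>a\<close>; it suffices because the perimeter \<open>D a c + D a c + D x x'\<close> of the triangle
  \<open>x, x', c\<close> is odd and therefore exceeds \<open>p\<close>. It is essential here that long odd perimeters are
  allowed: were all of them forbidden, \<open>\<Omega>\<close> would split into two parity classes.
\<close>

lemma orb_connected:
  assumes C: "finite C" "C \<subseteq> \<Omega>" and a: "a \<in> \<Omega> - C" and E: "finite E" "E \<subseteq> \<Omega>"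
    and step: "\<And>z z'. z \<in> orb C a - E \<Longrightarrow> z' \<in> orb C a - E \<Longrightarrow> D z z' = 2 \<Longrightarrow> \<phi> z = \<phi> z'"
    and x: "x \<in> orb C a - E" "x' \<in> orb C a - E"
  shows "\<phi> x = \<phi> x'"
proof (cases "even (D x x')")
  case True
  then obtain m where "D x x' = 2 * m" by (rule evenE)
  then show ?thesis
    using orb_connected_even[where \<phi> = \<phi>, OF C a E step x] by blast
next
  case odd: False
  let ?n = "D x x'"
  have x_mem: "x \<in> \<Omega>" "x' \<in> \<Omega>" "x \<noteq> x'"
    using x odd D_eq_0_iff[of x x] by (auto simp: orb_def)
  have adm: "admissible (D a c) (D a c) ?n" if "c \<in> C" for c
    using admissible_triangle[of x x' c] x_mem that C x by (auto simp: orb_def D_commute)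
  have "\<exists>L. even L \<and> 0 < L \<and> (\<forall>c\<in>C. L \<le> 2 * D a c) \<and> admissible L L ?n"
  proof (cases "C = {}")
    case True
    then show ?thesis
      by (intro exI[of _ "2 * (?n + p + 1)"]) (auto simp: admissible_def)
  next
    case False
    then obtain c where c: "c \<in> C" "\<forall>c'\<in>C. D a c \<le> D a c'"
      using ex_has_least_nat[of "\<lambda>c. c \<in> C" _ "D a"] by blast
    have "0 < D a c"
      using D_eq_0_iff[of a c] a c(1) C by auto
    then show ?thesis
      using adm[OF c(1)] c odd by (intro exI[of _ "2 * D a c"]) (auto simp: admissible_def)
  qed
  then obtain L where L: "even L" "0 < L" "\<And>c. c \<in> C \<Longrightarrow> L \<le> 2 * D a c" "admissible L L ?n"
    by blast
  then have "\<exists>z\<in>orb C a - E. D z x = L \<and> D z x' = L"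
    using x x_mem by (intro orb_intermediate_point C a E) auto
  then obtain z where z: "z \<in> orb C a - E" "D z x = L" "D z x' = L" by blast
  obtain m where "L = 2 * m"
    using L(1) by (rule evenE)
  then have "\<phi> z = \<phi> x" "\<phi> z = \<phi> x'"
    using orb_connected_even[where \<phi> = \<phi>, OF C a E step z(1)] x z by blast+
  then show ?thesis by simp
qed

end

section \<open>Unitary representations and vectors fixed by stabilizers\<close>

locale fraisse_rep = fraisse_space p \<Omega> d
  for p :: nat and \<Omega> :: "'a set" and d :: "'a \<Rightarrow> 'a \<Rightarrow> real" +
  fixes \<pi> :: "('a \<Rightarrow> 'a) \<Rightarrow> 'h::chilbert_space \<Rightarrow> 'h"
  assumes hom: "\<pi> \<in> hom (Isom \<Omega> d) unitary_group"
begin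

abbreviation Fix :: "'a set \<Rightarrow> 'h set" where
  "Fix A \<equiv> fixed_vectors (Isom \<Omega> d) \<pi> A"

abbreviation Proj :: "'a set \<Rightarrow> 'h \<Rightarrow> 'h" where
  "Proj A \<equiv> orth_proj (Fix A)"

sublocale G: group "Isom \<Omega> d"
  using subgroup.subgroup_is_group[OF subgroup_Isom group_BijGroup, of \<Omega> d]
  by (simp add: Isom_def)

lemma mult_apply:
  assumes "g \<in> carrier (Isom \<Omega> d)" "h \<in> carrier (Isom \<Omega> d)" "x \<in> \<Omega>"
  shows "(g \<otimes>\<^bsub>Isom \<Omega> d\<^esub> h) x = g (h x)"
  using assms by (simp add: Isom_def BijGroup_def compose_eq)

lemma inv_apply:
  assumes "g \<in> carrier (Isom \<Omega> d)" "x \<in> \<Omega>"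
  shows "(inv\<^bsub>Isom \<Omega> d\<^esub> g) (g x) = x"
proof -
  have "(inv\<^bsub>Isom \<Omega> d\<^esub> g) (g x) = \<one>\<^bsub>Isom \<Omega> d\<^esub> x"
    using mult_apply[OF G.inv_closed[OF assms(1)] assms] G.l_inv[OF assms(1)] by simp
  then show ?thesis
    using assms(2) by (simp add: Isom_def BijGroup_def)
qed

lemma stab_carrier: "g \<in> stab C \<Longrightarrow> g \<in> carrier (Isom \<Omega> d)"
  by (simp add: pointwise_stabilizer_def)

lemma stab_mult:
  assumes "g \<in> stab C" "h \<in> stab C" "C \<subseteq> \<Omega>"
  shows "g \<otimes>\<^bsub>Isom \<Omega> d\<^esub> h \<in> stab C"
  using assms mult_apply by (auto simp: pointwise_stabilizer_def subset_iff)

lemma unitary_op_\<pi>: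
  assumes "g \<in> carrier (Isom \<Omega> d)"
  shows "unitary_op (\<pi> g)"
  using hom_in_carrier[OF hom assms] by (simp add: unitary_group_def)

lemma \<pi>_mult:
  assumes "g \<in> carrier (Isom \<Omega> d)" "h \<in> carrier (Isom \<Omega> d)"
  shows "\<pi> (g \<otimes>\<^bsub>Isom \<Omega> d\<^esub> h) \<xi> = \<pi> g (\<pi> h \<xi>)"
  using hom_mult[OF hom assms] by (simp add: unitary_group_def)

lemma \<pi>_linear:
  assumes "g \<in> carrier (Isom \<Omega> d)"
  shows "\<pi> g (x + y) = \<pi> g x + \<pi> g y" "\<pi> g (x - y) = \<pi> g x - \<pi> g y"
    "\<pi> g (c *\<^sub>C x) = c *\<^sub>C \<pi> g x" "\<pi> g (r *\<^sub>R x) = r *\<^sub>R \<pi> g x" "\<pi> g 0 = 0"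
proof -
  interpret Vector_Spaces.linear "(*\<^sub>C)" "(*\<^sub>C)" "\<pi> g"
    using unitary_op_\<pi>[OF assms] by (simp add: unitary_op_def)
  show "\<pi> g (x + y) = \<pi> g x + \<pi> g y" "\<pi> g (x - y) = \<pi> g x - \<pi> g y"
    "\<pi> g (c *\<^sub>C x) = c *\<^sub>C \<pi> g x" "\<pi> g (r *\<^sub>R x) = r *\<^sub>R \<pi> g x" "\<pi> g 0 = 0"
    by (simp_all add: add diff scale zero scaleR_scaleC)
qed

lemma \<pi>_inner:
  assumes "g \<in> carrier (Isom \<Omega> d)"
  shows "inner (\<pi> g x) (\<pi> g y) = inner x y"
  using unitary_op_\<pi>[OF assms] by (simp add: unitary_op_def inner_eq_Re_cinner)

lemma \<pi>_norm:
  assumes "g \<in> carrier (Isom \<Omega> d)"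
  shows "norm (\<pi> g x) = norm x"
  using \<pi>_inner[OF assms] by (simp add: norm_eq_sqrt_inner)

lemma continuous_\<pi>:
  assumes "g \<in> carrier (Isom \<Omega> d)"
  shows "continuous_on S (\<pi> g)"
proof (rule continuous_onI)
  fix x e assume "0 < (e :: real)"
  then show "\<exists>\<delta>>0. \<forall>x'\<in>S. dist x' x < \<delta> \<longrightarrow> dist (\<pi> g x') (\<pi> g x) \<le> e"
    using \<pi>_norm[OF assms] \<pi>_linear(2)[OF assms, symmetric]
    by (intro exI[of _ e]) (simp add: dist_norm)
qed

lemma subspace_Fix: "complex_vs.subspace (Fix A)"
  by (rule complex_vs.subspaceI) (auto simp: fixed_vectors_def \<pi>_linear stab_carrier)

lemma closed_Fix: "closed (Fix A)"
proof -
  have "closed {\<xi>. \<pi> g \<xi> = \<xi>}" if "g \<in> stab A" for g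
    using continuous_\<pi>[OF stab_carrier[OF that]] by (intro closed_Collect_eq) auto
  then have "closed (\<Inter>g\<in>stab A. {\<xi>. \<pi> g \<xi> = \<xi>})"
    by (intro closed_INT) auto
  also have "(\<Inter>g\<in>stab A. {\<xi>. \<pi> g \<xi> = \<xi>}) = Fix A"
    by (auto simp: fixed_vectors_def)
  finally show ?thesis .
qed

lemma Fix_mono: "A \<subseteq> B \<Longrightarrow> Fix A \<subseteq> Fix B"
  by (auto simp: fixed_vectors_def pointwise_stabilizer_def)

lemma Proj_mem: "Proj A x \<in> Fix A"
  and Proj_orth: "z \<in> Fix A \<Longrightarrow> inner (x - Proj A x) z = 0"
  using orth_proj_exists[OF subspace_Fix closed_Fix] by blast+

section \<open>Equivariant families of vectors along an orbit\<close>

definition equivariant :: "'a set \<Rightarrow> 'a \<Rightarrow> ('a \<Rightarrow> 'h) \<Rightarrow> bool" where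
  "equivariant C a u \<longleftrightarrow> (\<forall>g\<in>stab C. \<forall>x\<in>orb C a. \<pi> g (u x) = u (g x))"

text \<open>
  A vector fixed by the stabilizer of \<open>insert a C\<close> is moved by elements of the stabilizer of \<open>C\<close>
  as the point \<open>a\<close> is, so it extends to a family of vectors indexed by the orbit of \<open>a\<close>.
\<close>

lemma \<pi>_eq_on_Fix:
  assumes C: "C \<subseteq> \<Omega>" "a \<in> \<Omega>" and \<xi>: "\<xi> \<in> Fix (insert a C)"
    and gh: "g \<in> stab C" "h \<in> stab C" "g a = h a"
  shows "\<pi> g \<xi> = \<pi> h \<xi>"
proof -
  note carrier = stab_carrier[OF gh(1)] stab_carrier[OF gh(2)]
  define k where "k = inv\<^bsub>Isom \<Omega> d\<^esub> h \<otimes>\<^bsub>Isom \<Omega> d\<^esub> g"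
  have k: "k \<in> carrier (Isom \<Omega> d)"
    using carrier by (simp add: k_def)
  have "k x = x" if "x \<in> insert a C" for x
  proof -
    have "x \<in> \<Omega>" "g x = h x"
      using that C gh by (auto simp: pointwise_stabilizer_def)
    then show ?thesis
      using carrier by (simp add: k_def mult_apply inv_apply)
  qed
  then have "\<pi> k \<xi> = \<xi>"
    using k \<xi> by (auto simp: fixed_vectors_def pointwise_stabilizer_def)
  moreover have "g = h \<otimes>\<^bsub>Isom \<Omega> d\<^esub> k"
    using carrier by (simp add: k_def flip: G.m_assoc)
  ultimately show ?thesis
    using \<pi>_mult[OF carrier(2) k, of \<xi>] by simp
qed

lemma equivariant_exists:
  assumes C: "finite C" "C \<subseteq> \<Omega>" and a: "a \<in> \<Omega>" and \<xi>: "\<xi> \<in> Fix (insert a C)"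
  obtains u where "u a = \<xi>" "equivariant C a u"
proof -
  have a_orb: "a \<in> orb C a"
    using a by (simp add: orb_def)
  have "\<exists>k\<in>stab C. k a = x" if "x \<in> orb C a" for x
    using stab_transitive_on_pairs[OF C a a, of x x] that a D_eq_0_iff[of x x] D_eq_0_iff[of a a]
    by (auto simp: orb_def)
  then obtain T where T: "\<And>x. x \<in> orb C a \<Longrightarrow> T x \<in> stab C" "\<And>x. x \<in> orb C a \<Longrightarrow> T x a = x"
    by metis
  show thesis
  proof
    show "\<pi> (T a) \<xi> = \<xi>"
      using T[OF a_orb] \<xi> by (auto simp: fixed_vectors_def pointwise_stabilizer_def)
    show "equivariant C a (\<lambda>x. \<pi> (T x) \<xi>)"
      unfolding equivariant_def
    proof (intro ballI)
      fix g x assume g: "g \<in> stab C" and x: "x \<in> orb C a"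
      note gx = orb_stab_mem[OF x g C(2)]
      have "\<pi> g (\<pi> (T x) \<xi>) = \<pi> (g \<otimes>\<^bsub>Isom \<Omega> d\<^esub> T x) \<xi>"
        using g T(1)[OF x] by (simp add: \<pi>_mult stab_carrier)
      also have "\<dots> = \<pi> (T (g x)) \<xi>"
        using g T[OF x] T[OF gx] a
        by (intro \<pi>_eq_on_Fix[OF C(2) a \<xi>] stab_mult C) (simp_all add: mult_apply stab_carrier)
      finally show "\<pi> g (\<pi> (T x) \<xi>) = \<pi> (T (g x)) \<xi>" .
    qed
  qed
qed

text \<open>
  By homogeneity, two pairs of orbit points at the same distance are related by an
  element of the stabilizer of \<open>C\<close>, which preserves inner products.
\<close>

lemma inner_depends_on_distance:
  assumes C: "finite C" "C \<subseteq> \<Omega>" and u: "equivariant C a u" and w: "equivariant C b w"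
    and x: "x \<in> orb C a" "x' \<in> orb C a" and y: "y \<in> orb C b" "y' \<in> orb C b"
    and D: "D x y = D x' y'"
  shows "inner (u x) (w y) = inner (u x') (w y')"
proof -
  obtain k where k: "k \<in> stab C" "k x = x'" "k y = y'"
    using stab_transitive_on_pairs[OF C, of x y x' y'] x y D by (auto simp: orb_def)
  have "inner (u x) (w y) = inner (\<pi> k (u x)) (\<pi> k (w y))"
    using k(1) by (simp add: \<pi>_inner stab_carrier)
  also have "\<dots> = inner (u x') (w y')"
    using k u w x(1) y(1) by (simp add: equivariant_def)
  finally show ?thesis .
qed

text \<open>
  Replace \<open>x\<close> and \<open>x'\<close> by \<open>n\<close> twins each, all these points being at mutual distance 2. Then all inner
  products between the vectors of different points agree, so that the differences
  \<open>u (t i) - u (t' i)\<close> are orthogonal to each other. They have the same norm and the same inner product with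
  \<open>w y\<close>, because the twins keep their distances to \<open>y\<close>. As \<open>n\<close> is arbitrary, this inner product vanishes.
\<close>

lemma inner_eq_at_distance_2:
  assumes C: "finite C" "C \<subseteq> \<Omega>" and a: "a \<in> \<Omega> - C" and b: "b \<in> \<Omega> - C"
    and u: "equivariant C a u" and w: "equivariant C b w"
    and x: "x \<in> orb C a" "x' \<in> orb C a" "D x x' = 2"
    and y: "y \<in> orb C b" "y \<noteq> x" "y \<noteq> x'"
  shows "inner (u x) (w y) = inner (u x') (w y)"
proof -
  define \<kappa> where "\<kappa> = inner (u x) (u x')"
  define s where "s = inner (u x) (u x)"
  have mem: "x \<in> \<Omega>" "x' \<in> \<Omega>" "y \<in> \<Omega>"
    using x y by (auto simp: orb_def)
  have notC: "x \<notin> C" "x' \<notin> C"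
    using x orb_disjoint[OF a C(2)] by blast+
  have self: "D z z = 0" if "z \<in> \<Omega>" for z
    using that D_eq_0_iff by blast
  have "\<exists>\<delta>. (\<forall>i<n. inner (\<delta> i) (w y) = inner (u x) (w y) - inner (u x') (w y) \<and>
        inner (\<delta> i) (\<delta> i) = 2 * (s - \<kappa>)) \<and>
      (\<forall>i<n. \<forall>j<n. i \<noteq> j \<longrightarrow> inner (\<delta> i) (\<delta> j) = 0)" for n :: nat
  proof -
    \<comment> \<open>The twins of \<open>x'\<close> are taken over the twins of \<open>x\<close>: as \<open>x'\<close> is at distance 2 from the latter, so
      are its twins.\<close>
    let ?F = "insert x (insert x' (insert y C))"
    have F: "finite ?F" "?F \<subseteq> \<Omega>" "x \<in> ?F"
      using C mem by auto
    obtain t where t: "\<And>i. i < n \<Longrightarrow> t i \<in> \<Omega>"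
        "\<And>i v. i < n \<Longrightarrow> v \<in> ?F - {x} \<Longrightarrow> D (t i) v = D x v"
        "\<And>i j. i < n \<Longrightarrow> j < n \<Longrightarrow> i \<noteq> j \<Longrightarrow> D (t i) (t j) = 2"
      using twin_sequence[OF F, of n] by blast
    let ?F' = "?F \<union> t ` {..<n}"
    have F': "finite ?F'" "?F' \<subseteq> \<Omega>" "x' \<in> ?F'"
      using F t(1) by auto
    obtain t' where t': "\<And>i. i < n \<Longrightarrow> t' i \<in> \<Omega>"
        "\<And>i v. i < n \<Longrightarrow> v \<in> ?F' - {x'} \<Longrightarrow> D (t' i) v = D x' v"
        "\<And>i j. i < n \<Longrightarrow> j < n \<Longrightarrow> i \<noteq> j \<Longrightarrow> D (t' i) (t' j) = 2"
      using twin_sequence[OF F', of n] by blast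
    have x_ne: "x \<noteq> x'"
      using x(3) self[OF mem(1)] by auto
    have t_x': "D (t i) x' = 2" if "i < n" for i
      using t(2)[OF that, of x'] x(3) x_ne by simp
    have tt': "D (t i) (t' j) = 2" if "i < n" "j < n" for i j
    proof -
      have "t i \<noteq> x'"
        using t_x'[OF that(1)] self[OF mem(2)] by auto
      then have "D (t' j) (t i) = D x' (t i)"
        using that by (intro t'(2)) auto
      then show ?thesis
        using t_x'[OF that(1)] by (simp add: D_commute[of _ "t i"])
    qed
    have "D (t i) c = D x c" "D (t' i) c = D x' c" if "i < n" "c \<in> C" for i c
      using notC that by (intro t(2) t'(2); auto)+
    then have orb: "t i \<in> orb C a" "t' i \<in> orb C a" if "i < n" for i
      using t(1) t'(1) x(1,2) that by (simp_all add: orb_def)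
    have Dy: "D (t i) y = D x y" "D (t' i) y = D x' y" if "i < n" for i
      using t(2)[OF that, of y] t'(2)[OF that, of y] y by auto
    note dep = inner_depends_on_distance[OF C u]
    have norms: "inner (u (t i)) (u (t i)) = s" "inner (u (t' i)) (u (t' i)) = s" if "i < n" for i
      unfolding s_def using orb[OF that] x(1) self t(1)[OF that] t'(1)[OF that] mem
      by (intro dep[OF u]; simp)+
    have cross: "inner (u (t i)) (u (t' j)) = \<kappa>" "inner (u (t' j)) (u (t i)) = \<kappa>"
      if "i < n" "j < n" for i j
    proof -
      show "inner (u (t i)) (u (t' j)) = \<kappa>"
        unfolding \<kappa>_def using orb that x tt' by (intro dep[OF u]) simp_all
      then show "inner (u (t' j)) (u (t i)) = \<kappa>"
        by (simp add: inner_commute)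
    qed
    have distinct: "inner (u (t i)) (u (t j)) = \<kappa>" "inner (u (t' i)) (u (t' j)) = \<kappa>"
      if "i < n" "j < n" "i \<noteq> j" for i j
      unfolding \<kappa>_def using orb that x t(3) t'(3) by (intro dep[OF u]; simp)+
    have y_prod: "inner (u (t i)) (w y) = inner (u x) (w y)" "inner (u (t' i)) (w y) = inner (u x') (w y)"
      if "i < n" for i
      using orb[OF that] x y Dy[OF that] by (intro dep[OF w]; simp)+
    show ?thesis
      by (rule exI[of _ "\<lambda>i. u (t i) - u (t' i)"])
        (auto simp: inner_diff_left inner_diff_right norms cross distinct y_prod)
  qed
  then have "inner (u x) (w y) - inner (u x') (w y) = 0"
    by (rule inner_eq_0_if_orthogonal_families)
  then show ?thesis by simp
qed

text \<open>
  The orbit of \<open>a\<close> stays connected by steps of length 2 when \<open>b\<close> is removed, and along such steps the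
  inner product with \<open>\<eta>\<close> does not change.
\<close>

lemma inner_translate_eq:
  assumes C: "finite C" "C \<subseteq> \<Omega>" and a: "a \<in> \<Omega> - C" and b: "b \<in> \<Omega> - C" and ab: "a \<noteq> b"
    and \<xi>: "\<xi> \<in> Fix (insert a C)" and \<eta>: "\<eta> \<in> Fix (insert b C)"
    and h: "h \<in> stab C" "h a \<noteq> b"
  shows "inner (\<pi> h \<xi>) \<eta> = inner \<xi> \<eta>"
proof -
  obtain u where u: "u a = \<xi>" "equivariant C a u"
    using equivariant_exists[OF C _ \<xi>] a by auto
  obtain w where w: "w b = \<eta>" "equivariant C b w"
    using equivariant_exists[OF C _ \<eta>] b by auto
  have orb: "a \<in> orb C a" "b \<in> orb C b"
    using a b by (auto simp: orb_def)
  have "inner (u a) (w b) = inner (u (h a)) (w b)"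
  proof (rule orb_connected[OF C a, of "{b}" "\<lambda>x. inner (u x) (w b)"])
    show "inner (u z) (w b) = inner (u z') (w b)"
      if "z \<in> orb C a - {b}" "z' \<in> orb C a - {b}" "D z z' = 2" for z z'
      using that orb by (intro inner_eq_at_distance_2[OF C a b u(2) w(2)]) auto
  qed (use orb ab h orb_stab_mem[OF orb(1) h(1) C(2)] b in auto)
  moreover have "\<pi> h (u a) = u (h a)"
    using u(2) h(1) orb(1) by (simp add: equivariant_def)
  ultimately show ?thesis
    using u(1) w(1) by simp
qed

section \<open>Orthogonality over a common base\<close>

text \<open>
  The stabilizer takes \<open>b\<close> to any of its twins over \<open>C\<close>, and one of them is outside \<open>P\<close>.
\<close>

lemma stab_moves_off_finite_set:
  assumes C: "finite C" "C \<subseteq> \<Omega>" and b: "b \<in> \<Omega> - C" and P: "finite P" "P \<subseteq> \<Omega>"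
  shows "\<exists>h\<in>stab C. b \<notin> h ` P"
proof -
  obtain b' where b': "b' \<in> \<Omega>" "D b' b = 2" "\<And>v. v \<in> insert b (C \<union> P) - {b} \<Longrightarrow> D b' v = D b v"
  proof -
    have "finite (insert b (C \<union> P))" "insert b (C \<union> P) \<subseteq> \<Omega>" "b \<in> insert b (C \<union> P)"
      using C b P by auto
    from twin[OF this] show ?thesis using that by blast
  qed
  have "\<exists>h\<in>stab C. h b' = b \<and> h b' = b"
    using b b' D_eq_0_iff[of b b] D_eq_0_iff[of b' b']
    by (intro stab_transitive_on_pairs C) auto
  then obtain h where h: "h \<in> stab C" "h b' = b" by blast
  have "b \<noteq> h v" if "v \<in> P" for v
  proof
    assume "b = h v"
    then have "D b' v = 0"
      using D_isometry[OF stab_carrier[OF h(1)] b'(1), of v] h(2) that P b D_eq_0_iff[of b b] by auto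
    then show False
      using b'(2) b'(3)[of v] that P b D_eq_0_iff[of b v] by (cases "v = b") auto
  qed
  then show ?thesis using h(1) by blast
qed

text \<open>
  The translates of \<open>\<xi>\<close> by the stabilizer of \<open>C\<close> have the inner product \<open>c\<close> with \<open>\<eta>\<close> unless they move
  \<open>a\<close> to \<open>b\<close>. Convex combinations of translates keep this property, up to finitely many points to be
  moved off \<open>b\<close>. The vectors orthogonal to \<open>Fix C\<close> with the property so relaxed form an invariant
  convex set. Its closure has a unique vector of least norm, which is therefore fixed by the
  stabilizer of \<open>C\<close>; being also orthogonal to \<open>Fix C\<close>, it is 0. So there are arbitrarily short
  vectors having, after a translation, the inner product \<open>c\<close> with \<open>\<eta>\<close>.
\<close>

lemma Fix_orthogonal:
  assumes C: "finite C" "C \<subseteq> \<Omega>" and a: "a \<in> \<Omega> - C" and b: "b \<in> \<Omega> - C" and ab: "a \<noteq> b"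
    and \<xi>: "\<xi> \<in> Fix (insert a C)" and \<eta>: "\<eta> \<in> Fix (insert b C)"
    and orth: "\<And>\<zeta>. \<zeta> \<in> Fix C \<Longrightarrow> inner \<xi> \<zeta> = 0"
  shows "inner \<xi> \<eta> = 0"
proof -
  define c where "c = inner \<xi> \<eta>"
  define N where "N = {v. \<forall>\<zeta>\<in>Fix C. inner v \<zeta> = 0}"
  \<comment> \<open>\<open>P\<close> stands for the finite set of points to which the translates combined in \<open>v\<close> move \<open>a\<close>.
    Passing to \<open>L\<close>, the vectors with some such \<open>P\<close>, avoids handling convex hulls explicitly.\<close>
  define const_off where "const_off P v \<longleftrightarrow>
      finite P \<and> P \<subseteq> \<Omega> \<and> (\<forall>h\<in>stab C. b \<notin> h ` P \<longrightarrow> inner (\<pi> h v) \<eta> = c)" for P v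
  define L where "L = {v \<in> N. \<exists>P. const_off P v}"
  have N_closed: "closed N"
  proof -
    have "closed (\<Inter>\<zeta>\<in>Fix C. {v. inner v \<zeta> = 0})"
      by (intro closed_INT ballI closed_Collect_eq continuous_intros)
    also have "(\<Inter>\<zeta>\<in>Fix C. {v. inner v \<zeta> = 0}) = N"
      by (auto simp: N_def)
    finally show ?thesis .
  qed
  have "const_off {a} \<xi>"
    unfolding const_off_def c_def using a inner_translate_eq[OF C a b ab \<xi> \<eta>] by auto
  then have "\<xi> \<in> L"
    using orth by (auto simp: L_def N_def)
  have "convex L"
  proof (rule convexI)
    fix v v' and s t :: real
    assume v: "v \<in> L" "v' \<in> L" and st: "0 \<le> s" "0 \<le> t" "s + t = 1"
    obtain P P' where P: "const_off P v" "const_off P' v'"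
      using v by (auto simp: L_def)
    have "s * c + t * c = c"
      using st(3) by (simp flip: distrib_right)
    then have "inner (\<pi> h (s *\<^sub>R v + t *\<^sub>R v')) \<eta> = c" if "h \<in> stab C" "b \<notin> h ` (P \<union> P')" for h
      using that P by (simp add: const_off_def \<pi>_linear stab_carrier inner_add_left image_Un)
    then have "const_off (P \<union> P') (s *\<^sub>R v + t *\<^sub>R v')"
      using P by (simp add: const_off_def)
    moreover have "s *\<^sub>R v + t *\<^sub>R v' \<in> N"
      using v by (simp add: L_def N_def inner_add_left)
    ultimately show "s *\<^sub>R v + t *\<^sub>R v' \<in> L"
      by (auto simp: L_def)
  qed
  have L_invariant: "\<pi> k v \<in> L" if k: "k \<in> stab C" and v: "v \<in> L" for k v
  proof -
    obtain P where P: "const_off P v"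
      using v by (auto simp: L_def)
    have "inner (\<pi> k v) \<zeta> = 0" if "\<zeta> \<in> Fix C" for \<zeta>
    proof -
      have "inner (\<pi> k v) \<zeta> = inner (\<pi> k v) (\<pi> k \<zeta>)"
        using that k by (simp add: fixed_vectors_def)
      then show ?thesis
        using v that k by (simp add: \<pi>_inner stab_carrier L_def N_def)
    qed
    then have "\<pi> k v \<in> N" by (simp add: N_def)
    have "inner (\<pi> h (\<pi> k v)) \<eta> = c" if h: "h \<in> stab C" "b \<notin> h ` k ` P" for h
    proof -
      have "(h \<otimes>\<^bsub>Isom \<Omega> d\<^esub> k) ` P = h ` k ` P"
        unfolding image_image using P h(1) k
        by (intro image_cong) (auto simp: const_off_def mult_apply stab_carrier subset_iff)
      then have "inner (\<pi> (h \<otimes>\<^bsub>Isom \<Omega> d\<^esub> k) v) \<eta> = c"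
        using P stab_mult[OF h(1) k C(2)] h(2) by (simp add: const_off_def)
      then show ?thesis
        using h(1) k by (simp add: \<pi>_mult stab_carrier)
    qed
    moreover have "finite (k ` P)" "k ` P \<subseteq> \<Omega>"
      using P Isom_mem[OF stab_carrier[OF k]] by (auto simp: const_off_def)
    ultimately have "const_off (k ` P) (\<pi> k v)"
      by (simp add: const_off_def)
    then show ?thesis
      using \<open>\<pi> k v \<in> N\<close> by (auto simp: L_def)
  qed
  have closure_invariant: "\<pi> k v \<in> closure L" if k: "k \<in> stab C" and v: "v \<in> closure L" for k v
  proof -
    have "\<pi> k ` closure L \<subseteq> closure L"
      using L_invariant[OF k] closure_subset[of L]
      by (intro image_closure_subset continuous_\<pi>[OF stab_carrier[OF k]]) auto
    then show ?thesis using v by blast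
  qed
  obtain v where v: "v \<in> closure L" "\<And>z. z \<in> closure L \<Longrightarrow> norm v \<le> norm z"
    using least_norm_exists[of "closure L"] \<open>\<xi> \<in> L\<close> \<open>convex L\<close> convex_closure closure_subset by blast
  have "\<pi> k v = v" if "k \<in> stab C" for k
    using v that by (intro least_norm_unique[OF convex_closure[OF \<open>convex L\<close>] v(1)])
      (simp_all add: closure_invariant \<pi>_norm stab_carrier)
  then have "v \<in> Fix C"
    by (simp add: fixed_vectors_def)
  moreover have "v \<in> N"
    using v(1) closure_minimal[OF _ N_closed, of L] by (auto simp: L_def)
  ultimately have "v = 0"
    unfolding N_def by (metis (mono_tags) inner_eq_zero_iff mem_Collect_eq)
  have "c = 0"
  proof (rule ccontr)
    assume "c \<noteq> 0"
    then have "0 < \<bar>c\<bar> / (norm \<eta> + 1)"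
      by (simp add: add_nonneg_pos)
    then obtain z where z: "z \<in> L" "norm z < \<bar>c\<bar> / (norm \<eta> + 1)"
      using v(1) \<open>v = 0\<close> unfolding closure_approachable by (auto simp: dist_norm)
    then obtain P where P: "const_off P z"
      by (auto simp: L_def)
    then obtain h where h: "h \<in> stab C" "b \<notin> h ` P"
      using stab_moves_off_finite_set[OF C b, of P] by (auto simp: const_off_def)
    have "inner (\<pi> h z) \<eta> = c"
      using P h by (simp add: const_off_def)
    then have "\<bar>c\<bar> \<le> norm z * norm \<eta>"
      using Cauchy_Schwarz_ineq2[of "\<pi> h z" \<eta>] h(1) by (simp add: \<pi>_norm stab_carrier)
    also have "\<dots> \<le> norm z * (norm \<eta> + 1)"
      by (intro mult_left_mono) auto
    also have "\<dots> < \<bar>c\<bar>"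
      using z(2) by (simp add: pos_less_divide_eq add_nonneg_pos)
    finally show False by simp
  qed
  then show ?thesis by (simp add: c_def)
qed

section \<open>Products of projections\<close>

lemma Proj_small_large: "A \<subseteq> B \<Longrightarrow> Proj A (Proj B x) = Proj A x"
proof -
  assume AB: "A \<subseteq> B"
  have "inner (x - Proj A (Proj B x)) z = 0" if z: "z \<in> Fix A" for z
    using Proj_orth[OF z, of "Proj B x"] Proj_orth[of z B x] Fix_mono[OF AB] z
    by (auto simp: inner_diff_left)
  then show ?thesis
    by (intro orth_proj_eqI[symmetric] subspace_Fix Proj_mem)
qed

lemma Proj_ident: "x \<in> Fix A \<Longrightarrow> Proj A x = x"
  by (intro orth_proj_eqI subspace_Fix) simp_all

lemma Proj_large_small: "A \<subseteq> B \<Longrightarrow> Proj B (Proj A x) = Proj A x"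
  using Fix_mono Proj_mem by (intro Proj_ident) blast

text \<open>
  For \<open>y\<close> in \<open>Fix (insert b C)\<close>, the vector \<open>y - Proj C y\<close> still lies in \<open>Fix (insert b C)\<close> and is
  orthogonal to \<open>Fix C\<close>, hence to \<open>Fix (insert a C)\<close>. So \<open>y\<close> has the same projection
  to \<open>Fix (insert a C)\<close> as to \<open>Fix C\<close>.
\<close>

lemma Proj_mult_one_point:
  assumes C: "finite C" "C \<subseteq> \<Omega>" and a: "a \<in> \<Omega> - C" and b: "b \<in> \<Omega> - C" and ab: "a \<noteq> b"
  shows "Proj (insert a C) (Proj (insert b C) x) = Proj C x"
proof -
  define y where "y = Proj (insert b C) x"
  have "Proj (insert a C) y = Proj C y"
  proof (rule orth_proj_eqI[OF subspace_Fix])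
    show "Proj C y \<in> Fix (insert a C)"
      using Proj_mem Fix_mono[of C "insert a C"] by blast
    fix z assume z: "z \<in> Fix (insert a C)"
    have "y - Proj C y \<in> Fix (insert b C)"
      using Proj_mem[of C y] Fix_mono[of C "insert b C"] Proj_mem[of "insert b C" x]
      by (intro complex_vs.subspace_diff[OF subspace_Fix]) (auto simp: y_def)
    then show "inner (y - Proj C y) z = 0"
      using Proj_orth ab by (intro Fix_orthogonal[OF C b a _ _ z]) auto
  qed
  then show ?thesis
    using Proj_small_large[of C "insert b C" x] by (auto simp: y_def)
qed

text \<open>
  If \<open>B - A\<close> has at least two elements and \<open>b\<close> is one of them, inserting the projection for
  \<open>A \<union> (B - {b})\<close> between the two factors changes nothing, as that set contains \<open>A\<close>. It forms with
  \<open>B\<close> and then \<open>B - {b}\<close> forms with \<open>A\<close> a pair of smaller symmetric difference. The case of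
  \<open>A - B\<close> is the mirror image, and one point on either side is the previous lemma.
\<close>

lemma Proj_mult:
  assumes "finite A" "finite B" "A \<subseteq> \<Omega>" "B \<subseteq> \<Omega>"
  shows "Proj A (Proj B x) = Proj (A \<inter> B) x"
  using assms
proof (induction "card (A - B) + card (B - A)" arbitrary: A B x rule: less_induct)
  case less
  consider "A \<subseteq> B" | "B \<subseteq> A" | a b where "a \<in> A - B" "b \<in> B - A" by blast
  then show ?case
  proof cases
    case 1
    then show ?thesis by (simp add: Proj_small_large Int_absorb2)
  next
    case 2
    then show ?thesis by (simp add: Proj_large_small Int_absorb1)
  next
    case (3 a b)
    have card_pos: "0 < card (A - B)" "0 < card (B - A)"
      using 3 less.prems by (auto simp: card_gt_0_iff)
    consider "A - B = {a}" "B - A = {b}" | b' where "b' \<in> B - A" "b' \<noteq> b" | a' where "a' \<in> A - B" "a' \<noteq> a"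
      using 3 by blast
    then show ?thesis
    proof cases
      case 1
      then have "insert a (A \<inter> B) = A" "insert b (A \<inter> B) = B"
        by blast+
      then show ?thesis
        using Proj_mult_one_point[of "A \<inter> B" a b x] 3 less.prems by auto
    next
      case (2 b')
      define A' where "A' = A \<union> (B - {b})"
      have "card {b, b'} \<le> card (B - A)"
        using 2 3 less.prems by (intro card_mono) auto
      then have two: "2 \<le> card (B - A)"
        using 2 by simp
      have A': "A' - B = A - B" "B - A' = {b}" "A' \<inter> B = B - {b}" "finite A'" "A' \<subseteq> \<Omega>" "A \<subseteq> A'"
        using 3 less.prems by (auto simp: A'_def)
      have "A - (B - {b}) = A - B" "B - {b} - A = (B - A) - {b}" "A \<inter> (B - {b}) = A \<inter> B"
        using 3 by auto
      note B' = this
      have "Proj A (Proj B x) = Proj A (Proj A' (Proj B x))"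
        using A'(6) by (simp add: Proj_small_large)
      also have "Proj A' (Proj B x) = Proj (A' \<inter> B) x"
        using A' less.prems two by (intro less.hyps) auto
      also have "Proj A (Proj (A' \<inter> B) x) = Proj (A \<inter> (B - {b})) x"
        unfolding A'(3) using 3 less.prems card_pos two
        by (intro less.hyps) (auto simp: B' card_Diff_singleton)
      finally show ?thesis by (simp add: B')
    next
      case (3 a')
      note a' = this
      define B' where "B' = B \<union> (A - {a})"
      have a: "a \<in> A" "a \<notin> B" "b \<in> B" "b \<notin> A"
        using \<open>a \<in> A - B\<close> \<open>b \<in> B - A\<close> by auto
      have "card {a, a'} \<le> card (A - B)"
        using a a' less.prems by (intro card_mono) auto
      then have two: "2 \<le> card (A - B)"
        using a' by simp
      have B': "B' - A = B - A" "A - B' = {a}" "A \<inter> B' = A - {a}" "finite B'" "B' \<subseteq> \<Omega>" "B \<subseteq> B'"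
        using a less.prems by (auto simp: B'_def)
      have A': "B - (A - {a}) = B - A" "A - {a} - B = (A - B) - {a}" "(A - {a}) \<inter> B = A \<inter> B"
        using a by auto
      have "Proj A (Proj B x) = Proj A (Proj B' (Proj B x))"
        using B'(6) by (simp add: Proj_large_small)
      also have "\<dots> = Proj (A \<inter> B') (Proj B x)"
        using B' less.prems two by (intro less.hyps) auto
      also have "\<dots> = Proj ((A - {a}) \<inter> B) x"
        unfolding B'(3) using a less.prems card_pos two
        by (intro less.hyps) (auto simp: A' card_Diff_singleton)
      finally show ?thesis by (simp add: A')
    qed
  qed
qed

end

section \<open>Dissociation\<close>

theorem theorem5p8:
  fixes p :: nat and \<Omega> :: "'a set" and d :: "'a \<Rightarrow> 'a \<Rightarrow> real"
  assumes "p \<ge> 1" and "is_M p \<Omega> d"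
  shows "dissociated TYPE('h::chilbert_space) \<Omega> (Isom \<Omega> d)"
  unfolding dissociated_def
proof (intro allI impI)
  fix \<pi> :: "('a \<Rightarrow> 'a) \<Rightarrow> 'h \<Rightarrow> 'h"
  assume "unitary_rep \<Omega> (Isom \<Omega> d) \<pi>"
  then interpret fraisse_rep p \<Omega> d \<pi>
    using assms(2) by unfold_locales (simp_all add: unitary_rep_def)
  show "dissociated_rep \<Omega> (Isom \<Omega> d) \<pi>"
    unfolding dissociated_rep_def by (auto simp: fun_eq_iff Proj_mult)
qed

end
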